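(* Let $h:[n]\to[n]$ be any Hessenberg function and let $P_h$ be the poset on $[n]$ with $i<_{P_h}j$ iff $h(i)<j$. Let $\mathcal{N}_h$ be the set of monomials $x_1^{i_1}\cdots x_n^{i_n}$ with $0\le i_k\le h(k)-k$ for $1\le k\le n$. Define $\varphi$ on $\mathcal{N}_h$ as follows: start with a column consisting of one box containing $n$; for $k=n-1,\ldots,1$ in turn, if $i_k=0$ insert a new box containing $k$ at the bottom of the column; if $i_k>0$, list the entries $k+1,\ldots,h(k)$ (already in the column) in order from lowest to highest position, and insert a new box containing $k$ directly above the $i_k$-th lowest entry of this list. Then $\varphi$ is a well-defined bijection from $\mathcal{N}_h$ to the set of $P_h$-tableaux of shape $(1^n)$, and for every $x_1^{i_1}\cdots x_n^{i_n}\in\mathcal{N}_h$ one has $i_1+\cdots+i_n=\mathrm{inv}_{P_h}(\varphi(x_1^{i_1}\cdots x_n^{i_n}))$.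
   Context: A Hessenberg function is $h:[n]\to[n]$ with $i\le h(i)$ for all $i$ and $h(i)\le h(i+1)$. A $P_h$-tableau of shape $(1^n)$ is a single column of $n$ boxes containing each element of $[n]$ exactly once such that whenever $j$ is directly above $i$, $j\not<_{P_h}i$. A $P_h$-inversion of such a tableau $T$ is a pair $i<j$ (as integers) with $i$ in a higher box than $j$ and $i,j$ incomparable in $P_h$; $\mathrm{inv}_{P_h}(T)$ is the number of $P_h$-inversions. (The set $\mathcal{N}_h$ is a known basis of $H^*(\mathrm{Hess}(N,h))$ for $N$ regular nilpotent.) *)

theory Defs
  imports "HOL-Library.Poly_Mapping" "HOL-Library.FuncSet"
begin

definition hessenberg :: "nat \<Rightarrow> (nat \<Rightarrow> nat) \<Rightarrow> bool" where
  "hessenberg n h \<longleftrightarrow>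
     h \<in> {1..n} \<rightarrow> {1..n} \<and>
     (\<forall>i\<in>{1..n}. i \<le> h i) \<and>
     (\<forall>i. 1 \<le> i \<and> i < n \<longrightarrow> h i \<le> h (i + 1))"

definition P_less :: "nat \<Rightarrow> (nat \<Rightarrow> nat) \<Rightarrow> nat \<Rightarrow> nat \<Rightarrow> bool" where
  "P_less n h i j \<longleftrightarrow> i \<in> {1..n} \<and> j \<in> {1..n} \<and> h i < j"

lemma P_less_strict_order:
  assumes "hessenberg n h"
  shows "irreflp (P_less n h)" and "transp (P_less n h)"
proof -
  have le: "i \<le> h i" if "i \<in> {1..n}" for i
    using assms that unfolding hessenberg_def by blast
  show "irreflp (P_less n h)"
    unfolding irreflp_def P_less_def using le leD by blast
  show "transp (P_less n h)"
    unfolding transp_def P_less_def using le by (meson le_less_trans less_trans)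
qed

definition P_incomparable :: "nat \<Rightarrow> (nat \<Rightarrow> nat) \<Rightarrow> nat \<Rightarrow> nat \<Rightarrow> bool" where
  "P_incomparable n h i j \<longleftrightarrow> i \<noteq> j \<and> \<not> P_less n h i j \<and> \<not> P_less n h j i"

text \<open>A column of boxes is the list of its entries read from top to bottom.\<close>

definition P_tableaux :: "nat \<Rightarrow> (nat \<Rightarrow> nat) \<Rightarrow> nat list set" where
  "P_tableaux n h =
     {T. length T = n \<and> set T = {1..n} \<and> distinct T \<and>
         (\<forall>p. p + 1 < n \<longrightarrow> \<not> P_less n h (T ! p) (T ! (p + 1)))}"

definition P_inversions :: "nat \<Rightarrow> (nat \<Rightarrow> nat) \<Rightarrow> nat list \<Rightarrow> (nat \<times> nat) set" where
  "P_inversions n h T =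
     {(i, j). i < j \<and> P_incomparable n h i j \<and>
              (\<exists>p q. p < q \<and> q < length T \<and> T ! p = i \<and> T ! q = j)}"

definition P_inv :: "nat \<Rightarrow> (nat \<Rightarrow> nat) \<Rightarrow> nat list \<Rightarrow> nat" where
  "P_inv n h T = card (P_inversions n h T)"

text \<open>A monomial \<open>x\<^sub>1\<^bsup>i\<^sub>1\<^esup> \<dots> x\<^sub>n\<^bsup>i\<^sub>n\<^esup>\<close> is represented by its finitely supported
  exponent vector, with \<open>i\<^sub>k = lookup m k\<close>.\<close>

definition N_monomials :: "nat \<Rightarrow> (nat \<Rightarrow> nat) \<Rightarrow> (nat \<Rightarrow>\<^sub>0 nat) set" where
  "N_monomials n h =
     {m. Poly_Mapping.keys m \<subseteq> {1..n} \<and>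
         (\<forall>k\<in>{1..n}. Poly_Mapping.lookup m k \<le> h k - k)}"

definition insert_above :: "nat \<Rightarrow> nat \<Rightarrow> nat list \<Rightarrow> nat list" where
  "insert_above k e C = takeWhile (\<lambda>x. x \<noteq> e) C @ k # dropWhile (\<lambda>x. x \<noteq> e) C"

text \<open>The entries \<open>k+1, \<dots>, h(k)\<close> of the column \<open>C\<close>, from lowest to highest position.\<close>

definition listed_entries :: "(nat \<Rightarrow> nat) \<Rightarrow> nat \<Rightarrow> nat list \<Rightarrow> nat list" where
  "listed_entries h k C = rev (filter (\<lambda>e. e \<in> {k+1..h k}) C)"

text \<open>Inserting \<open>k\<close> with exponent \<open>i\<close>.  The result is \<open>None\<close> exactly when the prescription makes
  no sense: for \<open>i > 0\<close>, when some of \<open>k+1, \<dots>, h(k)\<close> is not yet in the column or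
  there is no \<open>i\<close>-th listed entry.\<close>

definition insert_step :: "(nat \<Rightarrow> nat) \<Rightarrow> nat \<Rightarrow> nat \<Rightarrow> nat list \<Rightarrow> nat list option" where
  "insert_step h k i C =
     (if i = 0 then Some (C @ [k])
      else if {k+1..h k} \<subseteq> set C \<and> i \<le> length (listed_entries h k C)
      then Some (insert_above k (listed_entries h k C ! (i - 1)) C)
      else None)"

text \<open>The column after the first \<open>s\<close> insertions, that is, those of \<open>n-1, \<dots>, n-s\<close>.\<close>

primrec phi_steps ::
  "nat \<Rightarrow> (nat \<Rightarrow> nat) \<Rightarrow> (nat \<Rightarrow>\<^sub>0 nat) \<Rightarrow> nat \<Rightarrow> nat list option" where
  "phi_steps n h m 0 = Some [n]"
| "phi_steps n h m (Suc s) =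
     Option.bind (phi_steps n h m s)
       (insert_step h (n - Suc s) (Poly_Mapping.lookup m (n - Suc s)))"

definition phi :: "nat \<Rightarrow> (nat \<Rightarrow> nat) \<Rightarrow> (nat \<Rightarrow>\<^sub>0 nat) \<Rightarrow> nat list option" where
  "phi n h m = phi_steps n h m (n - 1)"

end

theory Submission
  imports Defs
begin

text \<open>For a column \<open>T\<close> let \<open>below h k T\<close> be the number of entries in \<open>{k+1..h k}\<close> lying below \<open>k\<close>.
  These numbers sum to the number of inversions. In a column with entries \<open>{k+1..n}\<close>, the
  places where \<open>k\<close> may be inserted without violating the tableau condition are the bottom and the
  places directly above an entry of \<open>{k+1..h k}\<close>. Inserting \<open>k\<close> with exponent \<open>i\<close> picks the unique
  such place with \<open>below h k T = i\<close>, and later insertions of smaller entries do not change this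
  number. Conversely, since \<open>h\<close> is monotone, deleting the smallest entry of a tableau leaves a
  tableau. So \<open>T \<mapsto> (below h k T)\<^sub>k\<close> is inverse to \<open>\<phi>\<close>.\<close>

section \<open>Counting entries below a given one\<close>

definition below :: "(nat \<Rightarrow> nat) \<Rightarrow> nat \<Rightarrow> nat list \<Rightarrow> nat" where
  "below h k T = length (filter (\<lambda>e. e \<in> {k+1..h k}) (tl (dropWhile (\<lambda>x. x \<noteq> k) T)))"

text \<open>The shape of the column right after \<open>k\<close> has been inserted. For entries in
  \<open>{1..n}\<close>, \<open>y \<le> h x\<close> is the negation of
  \<open>P_less n h x y\<close>.\<close>

definition partial_tableau :: "nat \<Rightarrow> (nat \<Rightarrow> nat) \<Rightarrow> nat \<Rightarrow> nat list \<Rightarrow> bool" where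
  "partial_tableau n h k C \<longleftrightarrow>
     distinct C \<and> set C = {k..n} \<and> successively (\<lambda>x y. y \<le> h x) C"

lemma dropWhile_neq_split:
  assumes "k \<notin> set A"
  shows "dropWhile (\<lambda>x. x \<noteq> k) (A @ k # B) = k # B"
  using assms by (induction A) auto

lemma takeWhile_neq_split:
  assumes "k \<notin> set A"
  shows "takeWhile (\<lambda>x. x \<noteq> k) (A @ k # B) = A"
  using assms by (induction A) auto

lemma below_split:
  assumes "k \<notin> set A"
  shows "below h k (A @ k # B) = length (filter (\<lambda>e. e \<in> {k+1..h k}) B)"
  using assms by (simp add: below_def dropWhile_neq_split)

text \<open>Entries smaller than \<open>k\<close> neither stop the \<open>dropWhile\<close> nor lie
  in \<open>{k+1..h k}\<close>.\<close>

lemma below_filter: "below h k (filter (\<lambda>x. k \<le> x) T) = below h k T"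
proof (induction T)
  case (Cons a T)
  show ?case
  proof (cases "a = k")
    case True
    then show ?thesis
      by (auto simp: below_def intro!: arg_cong[where f = length] filter_cong)
  next
    case False
    then show ?thesis using Cons by (simp add: below_def)
  qed
qed (simp add: below_def)

lemma below_insert_smaller:
  assumes "k < l"
  shows "below h l (A @ k # B) = below h l (A @ B)"
  using below_filter[of h l "A @ k # B"] below_filter[of h l "A @ B"] assms by simp

section \<open>Cutting a column at a prescribed count\<close>

lemma length_filter_interval:
  fixes C :: "nat list"
  assumes "distinct C" "{k+1..m} \<subseteq> set C"
  shows "length (filter (\<lambda>e. e \<in> {k+1..m}) C) = m - k"
proof -
  have "length (filter (\<lambda>e. e \<in> {k+1..m}) C) = card (set (filter (\<lambda>e. e \<in> {k+1..m}) C))"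
    using assms(1) by (intro distinct_card[symmetric] distinct_filter)
  also have "set (filter (\<lambda>e. e \<in> {k+1..m}) C) = {k+1..m}"
    using assms(2) by auto
  finally show ?thesis by simp
qed

text \<open>Finds the insertion place for exponent \<open>i\<close>: directly above an entry
  satisfying \<open>P\<close>, or at the bottom, which is forced when \<open>i = 0\<close>.\<close>

lemma split_at_filter_count:
  assumes "i \<le> length (filter P C)"
  shows "\<exists>A B. C = A @ B \<and> (B = [] \<or> P (hd B)) \<and> length (filter P B) = i"
  using assms
proof (induction C)
  case (Cons a C)
  show ?case
  proof (cases "i \<le> length (filter P C)")
    case True
    with Cons.IH obtain A B where
      "C = A @ B" "B = [] \<or> P (hd B)" "length (filter P B) = i" by blast
    then show ?thesis by (intro exI[of _ "a # A"] exI[of _ B]) simp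
  next
    case False
    \<comment> \<open>The tail is one short of \<open>i\<close>, so \<open>a\<close> itself must be
      counted and the cut falls before it.\<close>
    with Cons.prems have "P a" "length (filter P (a # C)) = i"
      by (auto split: if_splits)
    then show ?thesis by (intro exI[of _ "[]"] exI[of _ "a # C"]) simp
  qed
qed simp

text \<open>If \<open>i\<close> listed entries lie in a nonempty \<open>B\<close>, then
  \<open>hd B\<close> is the topmost of them, hence the \<open>i\<close>-th lowest of all. An empty
  \<open>B\<close> is the case \<open>i = 0\<close>.\<close>

lemma insert_step_split:
  assumes "distinct (A @ B)" "{k+1..h k} \<subseteq> set (A @ B)"
    and "B = [] \<or> hd B \<in> {k+1..h k}"
  shows "insert_step h k (length (filter (\<lambda>e. e \<in> {k+1..h k}) B)) (A @ B) = Some (A @ k # B)"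
proof (cases B)
  case Nil
  then show ?thesis by (simp add: insert_step_def)
next
  case (Cons b B')
  let ?P = "\<lambda>e. e \<in> {k+1..h k}"
  have b: "b \<in> {k+1..h k}" using assms(3) Cons by simp
  \<comment> \<open>Reversal puts the listed entries under \<open>b\<close> first, so the 0-based
    index of \<open>b\<close> is their number, one less than the exponent.\<close>
  have "listed_entries h k (A @ B) = rev (filter ?P B') @ b # rev (filter ?P A)"
    using b Cons by (simp add: listed_entries_def)
  then have nth: "listed_entries h k (A @ B) ! length (filter ?P B') = b"
    by (simp only: nth_append length_rev) simp
  have ins: "insert_above k b (A @ B) = A @ k # B"
    using assms(1) Cons
    by (auto simp: insert_above_def dropWhile_neq_split takeWhile_neq_split)
  have len: "length (filter ?P B) = Suc (length (filter ?P B'))"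
    using b Cons by simp
  have "length (filter ?P B) \<le> length (listed_entries h k (A @ B))"
    by (simp add: listed_entries_def)
  then show ?thesis
    using assms(2) nth ins len by (simp add: insert_step_def del: filter.simps)
qed

section \<open>Inserting and deleting the smallest entry\<close>

lemma hessenberg_bounds:
  assumes "hessenberg n h" "k \<in> {1..n}"
  shows "k \<le> h k" "h k \<le> n"
  using assms by (auto simp: hessenberg_def Pi_iff)

lemma hessenberg_mono:
  assumes "hessenberg n h" "1 \<le> i" "i \<le> j" "j \<le> n"
  shows "h i \<le> h j"
  using assms(3,4)
proof (induction j rule: dec_induct)
  case (step j)
  have "h j \<le> h (j + 1)"
    using assms(1,2) step by (auto simp: hessenberg_def)
  then show ?case using step by simp
qed simp

text \<open>Only the two neighbours of \<open>k\<close> matter. The one above is harmless, since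
  \<open>last A > k\<close> gives \<open>k \<le> h (last A)\<close>; the one below is controlled by
  the choice of cut.\<close>

lemma partial_tableau_insert:
  assumes "hessenberg n h" "1 \<le> k" "k < n"
    and "partial_tableau n h (Suc k) (A @ B)"
    and "B = [] \<or> hd B \<in> {k+1..h k}"
  shows "partial_tableau n h k (A @ k # B)"
proof -
  have set: "set A \<union> set B = {Suc k..n}" and dist: "distinct (A @ B)"
    and succ: "successively (\<lambda>x y. y \<le> h x) (A @ B)"
    using assms(4) by (auto simp: partial_tableau_def)
  have "k \<notin> set A \<union> set B" using set by simp
  moreover have "k \<le> h (last A)" if "A \<noteq> []"
  proof -
    have "last A \<in> set A \<union> set B" using that by simp
    then have "last A \<in> {Suc k..n}" unfolding set .
    then show ?thesis using hessenberg_bounds(1)[OF assms(1), of "last A"] assms(2) by auto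
  qed
  moreover have "set (A @ k # B) = {k..n}"
    using set assms(3) by auto
  ultimately show ?thesis
    using dist succ assms(5)
    by (auto simp: partial_tableau_def successively_append_iff successively_Cons)
qed

text \<open>Deleting \<open>k\<close> creates at most one new adjacency, \<open>last A\<close> over
  \<open>hd B\<close>. Monotonicity of \<open>h\<close> makes it legal:
  \<open>hd B \<le> h k \<le> h (last A)\<close>, as \<open>k < last A\<close>.\<close>

lemma partial_tableau_remove:
  assumes "hessenberg n h" "1 \<le> k"
    and "partial_tableau n h k (A @ k # B)"
  shows "partial_tableau n h (Suc k) (A @ B)" "B = [] \<or> hd B \<in> {k+1..h k}"
proof -
  have set: "set (A @ k # B) = {k..n}" and dist: "distinct (A @ k # B)"
    and succ: "successively (\<lambda>x y. y \<le> h x) (A @ k # B)"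
    using assms(3) by (auto simp: partial_tableau_def)
  have "set A \<union> set B = {k..n} - {k}" using set dist by auto
  also have "\<dots> = {Suc k..n}" by auto
  finally have set': "set A \<union> set B = {Suc k..n}" .
  show hd: "B = [] \<or> hd B \<in> {k+1..h k}"
  proof (cases B)
    case (Cons b B')
    then have "b \<in> set A \<union> set B" by simp
    then have "b \<in> {Suc k..n}" unfolding set' .
    then show ?thesis using succ Cons by (simp add: successively_append_iff)
  qed simp
  have "hd B \<le> h (last A)" if "A \<noteq> []" "B \<noteq> []"
  proof -
    have "last A \<in> set A \<union> set B" using that by simp
    then have "last A \<in> {Suc k..n}" unfolding set' .
    then have "h k \<le> h (last A)" using hessenberg_mono[OF assms(1,2)] by auto
    then show ?thesis using hd that by auto
  qed
  then show "partial_tableau n h (Suc k) (A @ B)"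
    using dist succ set'
    by (auto simp: partial_tableau_def successively_append_iff successively_Cons)
qed

lemma P_tableaux_iff:
  "T \<in> P_tableaux n h \<longleftrightarrow> partial_tableau n h 1 T"
proof -
  have "(\<forall>p. p + 1 < n \<longrightarrow> \<not> P_less n h (T ! p) (T ! (p + 1))) \<longleftrightarrow>
        successively (\<lambda>x y. y \<le> h x) T" if "length T = n" "set T = {1..n}"
  proof -
    have "T ! p \<in> {1..n}" if "p < n" for p
      using that \<open>length T = n\<close> \<open>set T = {1..n}\<close> nth_mem by blast
    then have "\<not> P_less n h (T ! p) (T ! (p + 1)) \<longleftrightarrow> T ! Suc p \<le> h (T ! p)" if "p + 1 < n" for p
      using that by (auto simp: P_less_def not_less)
    then show ?thesis
      using \<open>length T = n\<close> by (auto simp: successively_conv_nth)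
  qed
  moreover have "length T = n" if "distinct T" "set T = {1..n}"
    using distinct_card[OF that(1)] that(2) by simp
  ultimately show ?thesis
    by (auto simp: P_tableaux_def partial_tableau_def)
qed

section \<open>Restricting tableaux and running the insertions\<close>

lemma filter_Suc_le_split:
  assumes "filter (\<lambda>x. k \<le> x) T = A @ k # B" "\<forall>x\<in>set (A @ B). Suc k \<le> x"
  shows "filter (\<lambda>x. Suc k \<le> x) T = A @ B"
proof -
  have "filter (\<lambda>x. Suc k \<le> x) T = filter (\<lambda>x. Suc k \<le> x) (filter (\<lambda>x. k \<le> x) T)"
    by (auto simp: filter_filter intro: filter_cong)
  also have "\<dots> = filter (\<lambda>x. Suc k \<le> x) (A @ B)"
    using assms(1) by simp
  also have "\<dots> = A @ B"
    using assms(2) by (rule filter_True)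
  finally show ?thesis .
qed

text \<open>Follows by deleting \<open>1\<close>, \<open>2\<close>, ..., \<open>k-1\<close> in turn,
  each the smallest entry at its time.\<close>

lemma partial_tableau_filter:
  assumes "hessenberg n h" "partial_tableau n h 1 T" "1 \<le> k" "k \<le> n"
  shows "partial_tableau n h k (filter (\<lambda>x. k \<le> x) T)"
  using assms(3,4)
proof (induction k rule: dec_induct)
  case base
  have "filter (\<lambda>x. 1 \<le> x) T = T"
    using assms(2) by (auto simp: partial_tableau_def intro: filter_True)
  then show ?case using assms(2) by simp
next
  case (step k)
  then have tab: "partial_tableau n h k (filter (\<lambda>x. k \<le> x) T)" by simp
  then have "k \<in> set (filter (\<lambda>x. k \<le> x) T)"
    using step by (simp add: partial_tableau_def)
  then obtain A B where AB: "filter (\<lambda>x. k \<le> x) T = A @ k # B"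
    by (meson split_list)
  have "set A \<union> set B \<subseteq> {k..n} - {k}"
    using tab AB by (auto simp: partial_tableau_def)
  then have "\<forall>x\<in>set A \<union> set B. Suc k \<le> x" by auto
  then have "filter (\<lambda>x. Suc k \<le> x) T = A @ B"
    using AB by (intro filter_Suc_le_split) auto
  then show ?case
    using partial_tableau_remove(1)[OF assms(1) step.hyps(1)] tab AB by simp
qed

text \<open>Gives well-definedness and, since the exponents can be read off the column,
  injectivity.\<close>

lemma phi_steps_invariant:
  assumes "hessenberg n h" "m \<in> N_monomials n h" "s < n"
  shows "\<exists>C. phi_steps n h m s = Some C \<and> partial_tableau n h (n - s) C \<and>
             (\<forall>k\<in>{n-s..n}. below h k C = Poly_Mapping.lookup m k)"
  using assms(3)
proof (induction s)
  case 0
  have "n \<in> {1..n}" using 0 by simp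
  \<comment> \<open>\<open>h n = n\<close> forces exponent 0 at \<open>n\<close>, in agreement with
    the starting column \<open>[n]\<close>, where nothing lies below \<open>n\<close>.\<close>
  then have "h n - n = 0" using hessenberg_bounds[OF assms(1)] by fastforce
  moreover have "Poly_Mapping.lookup m n \<le> h n - n"
    using assms(2) \<open>n \<in> {1..n}\<close> by (auto simp: N_monomials_def)
  ultimately have "Poly_Mapping.lookup m n = 0" by simp
  then show ?case by (simp add: partial_tableau_def below_def)
next
  case (Suc s)
  define k where "k = n - Suc s"
  have k: "1 \<le> k" "k < n" "n - s = Suc k" using Suc.prems by (auto simp: k_def)
  obtain C where C: "phi_steps n h m s = Some C" "partial_tableau n h (Suc k) C"
      "\<forall>l\<in>{Suc k..n}. below h l C = Poly_Mapping.lookup m l"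
    using Suc k by auto
  have dist: "distinct C" and set: "set C = {Suc k..n}"
    using C(2) by (auto simp: partial_tableau_def)
  have sub: "{k+1..h k} \<subseteq> set C"
    using set hessenberg_bounds(2)[OF assms(1), of k] k by auto
  have "Poly_Mapping.lookup m k \<le> h k - k"
    using assms(2) k by (auto simp: N_monomials_def)
  \<comment> \<open>All \<open>h k - k\<close> listed entries are already present, so the bound on
    the exponent ensures that such a cut exists.\<close>
  then obtain A B where AB: "C = A @ B" "B = [] \<or> hd B \<in> {k+1..h k}"
      "length (filter (\<lambda>e. e \<in> {k+1..h k}) B) = Poly_Mapping.lookup m k"
    using split_at_filter_count[of _ "\<lambda>e. e \<in> {k+1..h k}" C]
      length_filter_interval[OF dist sub] by metis
  have "insert_step h k (Poly_Mapping.lookup m k) C = Some (A @ k # B)"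
    using insert_step_split[of A B k h] dist sub AB by simp
  then have "phi_steps n h m (Suc s) = Some (A @ k # B)"
    using C(1) by (simp add: k_def)
  moreover have "partial_tableau n h k (A @ k # B)"
    using partial_tableau_insert[OF assms(1) k(1,2)] C(2) AB by simp
  moreover have "below h l (A @ k # B) = Poly_Mapping.lookup m l" if "l \<in> {k..n}" for l
  proof (cases "l = k")
    case True
    moreover have "k \<notin> set C" using set by simp
    then have "k \<notin> set A" using AB(1) by simp
    ultimately show ?thesis using AB(3) by (simp add: below_split)
  next
    case False
    then show ?thesis using that C(3) AB(1) by (simp add: below_insert_smaller)
  qed
  ultimately show ?case unfolding k_def by blast
qed

text \<open>For surjectivity: fed with the counts of \<open>T\<close>, the insertions rebuild
  \<open>T\<close> through its restrictions to the largest entries.\<close>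

lemma phi_steps_below:
  assumes "hessenberg n h" "partial_tableau n h 1 T"
    and "\<And>k. k \<in> {1..n} \<Longrightarrow> Poly_Mapping.lookup m k = below h k T" and "s < n"
  shows "phi_steps n h m s = Some (filter (\<lambda>x. n - s \<le> x) T)"
  using assms(4)
proof (induction s)
  case 0
  then have tab: "partial_tableau n h n (filter (\<lambda>x. n \<le> x) T)"
    using partial_tableau_filter[OF assms(1,2)] by simp
  then have "set (filter (\<lambda>x. n \<le> x) T) = {n}" "distinct (filter (\<lambda>x. n \<le> x) T)"
    unfolding partial_tableau_def by auto
  then have "filter (\<lambda>x. n \<le> x) T = [n]"
    by (metis distinct_card card.empty card_insert_disjoint empty_iff finite.emptyI
        length_0_conv length_Suc_conv list.set_intros(1) singletonD)
  then show ?case by simp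
next
  case (Suc s)
  define k where "k = n - Suc s"
  have k: "1 \<le> k" "k < n" "n - s = Suc k" using Suc.prems by (auto simp: k_def)
  have tab: "partial_tableau n h k (filter (\<lambda>x. k \<le> x) T)"
    using partial_tableau_filter[OF assms(1,2)] k by simp
  then have "k \<in> set (filter (\<lambda>x. k \<le> x) T)"
    using k by (simp add: partial_tableau_def)
  then obtain A B where AB: "filter (\<lambda>x. k \<le> x) T = A @ k # B"
    by (meson split_list)
  have dist: "distinct (A @ k # B)" and set: "set (A @ k # B) = {k..n}"
    using tab AB by (auto simp: partial_tableau_def)
  have "set A \<union> set B = {k..n} - {k}"
    using dist set by auto
  also have "\<dots> = {Suc k..n}" by auto
  finally have set': "set (A @ B) = {Suc k..n}" by simp
  then have "\<forall>x\<in>set (A @ B). Suc k \<le> x" by simp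
  then have "filter (\<lambda>x. Suc k \<le> x) T = A @ B"
    using AB by (intro filter_Suc_le_split) auto
  then have IH: "phi_steps n h m s = Some (A @ B)" using Suc k by simp
  have "below h k T = below h k (A @ k # B)"
    using below_filter[of h k T] AB by simp
  also have "\<dots> = length (filter (\<lambda>e. e \<in> {k+1..h k}) B)"
    using dist by (intro below_split) auto
  finally have "Poly_Mapping.lookup m k = length (filter (\<lambda>e. e \<in> {k+1..h k}) B)"
    using assms(3)[of k] k by simp
  moreover have "{k+1..h k} \<subseteq> set (A @ B)"
    using set' hessenberg_bounds(2)[OF assms(1), of k] k by auto
  \<comment> \<open>The tableau condition at \<open>k\<close> says that \<open>k\<close> stands at
    an admissible cut, so the insertion with this count puts it exactly there.\<close>
  moreover have "B = [] \<or> hd B \<in> {k+1..h k}"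
    using partial_tableau_remove(2)[OF assms(1) k(1)] tab AB by simp
  ultimately have "insert_step h k (Poly_Mapping.lookup m k) (A @ B) = Some (A @ k # B)"
    using insert_step_split[of A B k h] dist by simp
  then show ?case using IH AB by (simp add: k_def)
qed

section \<open>Range of the counts and their sum\<close>

lemma below_le:
  assumes "distinct T" "k \<in> set T" "{k+1..h k} \<subseteq> set T"
  shows "below h k T \<le> h k - k"
proof -
  obtain A B where "T = A @ k # B" "k \<notin> set A"
    using split_list_first[OF assms(2)] by blast
  then have "below h k T \<le> length (filter (\<lambda>e. e \<in> {k+1..h k}) T)"
    by (simp add: below_split)
  then show ?thesis using length_filter_interval[OF assms(1,3)] by simp
qed

text \<open>Translates the positions \<open>p < q\<close> in the definition of inversions into the
  list suffix used by \<open>below\<close>.\<close>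

lemma mem_after_iff:
  assumes "distinct T" "i \<in> set T"
  shows "j \<in> set (tl (dropWhile (\<lambda>x. x \<noteq> i) T)) \<longleftrightarrow>
         (\<exists>p q. p < q \<and> q < length T \<and> T ! p = i \<and> T ! q = j)"
proof -
  obtain A B where T: "T = A @ i # B" "i \<notin> set A"
    using split_list_first[OF assms(2)] by blast
  have nth: "T ! length A = i" using T by simp
  \<comment> \<open>Distinctness pins \<open>p\<close> to \<open>length A\<close>, the only position
    of \<open>i\<close>.\<close>
  have "(\<exists>p q. p < q \<and> q < length T \<and> T ! p = i \<and> T ! q = j) \<longleftrightarrow>
        (\<exists>q. length A < q \<and> q < length T \<and> T ! q = j)"
    using nth_eq_iff_index_eq[OF assms(1), of _ "length A"] nth T(1)
    by (metis less_trans length_append length_Cons less_add_Suc1 add_Suc_right)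
  also have "\<dots> \<longleftrightarrow> (\<exists>r < length B. B ! r = j)"
  proof
    assume "\<exists>q. length A < q \<and> q < length T \<and> T ! q = j"
    then obtain q where "length A < q" "q < length T" "T ! q = j" by blast
    then show "\<exists>r < length B. B ! r = j"
      using T(1) by (intro exI[of _ "q - Suc (length A)"]) (auto simp: nth_append nth_Cons')
  next
    assume "\<exists>r < length B. B ! r = j"
    then obtain r where "r < length B" "B ! r = j" by blast
    then show "\<exists>q. length A < q \<and> q < length T \<and> T ! q = j"
      using T(1) by (intro exI[of _ "Suc (length A + r)"]) (auto simp: nth_append)
  qed
  finally show ?thesis
    using T by (simp add: dropWhile_neq_split in_set_conv_nth)
qed

text \<open>Inversions are grouped by their smaller entry, which is the upper one; the group of
  \<open>k\<close> has \<open>below h k T\<close> members.\<close>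

lemma P_inv_eq_sum_below:
  assumes "hessenberg n h" "partial_tableau n h 1 T"
  shows "P_inv n h T = (\<Sum>k=1..n. below h k T)"
proof -
  have dist: "distinct T" and set: "set T = {1..n}"
    using assms(2) by (auto simp: partial_tableau_def)
  let ?F = "\<lambda>k. set (filter (\<lambda>e. e \<in> {k+1..h k}) (tl (dropWhile (\<lambda>x. x \<noteq> k) T)))"
  \<comment> \<open>The relation \<open>P_less n h j i\<close> is impossible, because
    \<open>i < j \<le> h j\<close>.\<close>
  have inc: "P_incomparable n h i j \<longleftrightarrow> j \<le> h i" if "i < j" "i \<in> {1..n}" "j \<in> {1..n}" for i j
    using that hessenberg_bounds(1)[OF assms(1), of j]
    by (auto simp: P_incomparable_def P_less_def)
  have after: "set (tl (dropWhile (\<lambda>x. x \<noteq> k) T)) \<subseteq> {1..n}" for k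
    by (metis set set_dropWhileD list.set_sel(2) subsetI tl_Nil)
  have "P_inversions n h T = (SIGMA k:{1..n}. ?F k)"
  proof (intro set_eqI iffI; clarify)
    fix i j assume "(i, j) \<in> P_inversions n h T"
    then have ij: "i < j" "P_incomparable n h i j"
        "\<exists>p q. p < q \<and> q < length T \<and> T ! p = i \<and> T ! q = j"
      by (auto simp: P_inversions_def)
    then have "i \<in> {1..n}" "j \<in> {1..n}"
      using set by (metis less_trans nth_mem)+
    then show "i \<in> {1..n} \<and> j \<in> ?F i"
      using ij inc[of i j] mem_after_iff[OF dist, of i j] set by auto
  next
    fix i j assume i: "i \<in> {1..n}" and j: "j \<in> ?F i"
    then have "j \<in> {1..n}" using after[of i] by auto
    then show "(i, j) \<in> P_inversions n h T"
      using i j inc[of i j] mem_after_iff[OF dist, of i j] set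
      by (auto simp: P_inversions_def)
  qed
  then have "P_inv n h T = (\<Sum>k=1..n. card (?F k))"
    by (simp add: P_inv_def del: set_filter)
  also have "\<dots> = (\<Sum>k=1..n. below h k T)"
    unfolding below_def
    by (intro sum.cong refl distinct_card distinct_filter distinct_tl distinct_dropWhile dist)
  finally show ?thesis .
qed

section \<open>Bijectivity and the inversion count\<close>

theorem theoremD:
  fixes n :: nat and h :: "nat \<Rightarrow> nat"
  assumes "n \<ge> 1" and "hessenberg n h"
  shows "(\<forall>m\<in>N_monomials n h. phi n h m \<noteq> None) \<and>
         bij_betw (\<lambda>m. the (phi n h m)) (N_monomials n h) (P_tableaux n h) \<and>
         (\<forall>m\<in>N_monomials n h.
            (\<Sum>k=1..n. Poly_Mapping.lookup m k) = P_inv n h (the (phi n h m)))"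
proof -
  have phi: "\<exists>T. phi n h m = Some T \<and> partial_tableau n h 1 T \<and>
               (\<forall>k\<in>{1..n}. below h k T = Poly_Mapping.lookup m k)"
    if "m \<in> N_monomials n h" for m
    using phi_steps_invariant[OF assms(2) that, of "n - 1"] assms(1) by (simp add: phi_def)
  have inj: "inj_on (\<lambda>m. the (phi n h m)) (N_monomials n h)"
  proof (rule inj_onI)
    fix m m' assume m: "m \<in> N_monomials n h" "m' \<in> N_monomials n h"
      and eq: "the (phi n h m) = the (phi n h m')"
    \<comment> \<open>Inside \<open>{1..n}\<close> both exponents equal \<open>below h k\<close> of
      the common column; outside, both vanish.\<close>
    have "Poly_Mapping.lookup m k = Poly_Mapping.lookup m' k" for k
    proof (cases "k \<in> {1..n}")
      case True
      then show ?thesis using phi[OF m(1)] phi[OF m(2)] eq by fastforce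
    next
      case False
      then have "k \<notin> Poly_Mapping.keys m" "k \<notin> Poly_Mapping.keys m'"
        using m by (auto simp: N_monomials_def)
      then show ?thesis by (simp add: in_keys_iff)
    qed
    then show "m = m'" by (intro poly_mapping_eqI)
  qed
  have surj: "T \<in> (\<lambda>m. the (phi n h m)) ` N_monomials n h" if "T \<in> P_tableaux n h" for T
  proof -
    have tab: "partial_tableau n h 1 T" using that by (simp add: P_tableaux_iff)
    then have dist: "distinct T" and set: "set T = {1..n}"
      by (auto simp: partial_tableau_def)
    \<comment> \<open>The preimage has the counts of \<open>T\<close> as exponents; the value 0
      outside \<open>{1..n}\<close> gives finite support and keeps the keys in range.\<close>
    define m where "m = Abs_poly_mapping (\<lambda>k. if k \<in> {1..n} then below h k T else 0)"
    have "finite {k. (if k \<in> {1..n} then below h k T else 0) \<noteq> 0}"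
      by (rule finite_subset[of _ "{1..n}"]) auto
    then have lookup: "Poly_Mapping.lookup m = (\<lambda>k. if k \<in> {1..n} then below h k T else 0)"
      unfolding m_def by (rule lookup_Abs_poly_mapping)
    have "below h k T \<le> h k - k" if "k \<in> {1..n}" for k
      using that set dist hessenberg_bounds(2)[OF assms(2) that] by (intro below_le) auto
    then have "m \<in> N_monomials n h"
      by (auto simp: N_monomials_def lookup in_keys_iff split: if_splits)
    moreover have "phi n h m = Some (filter (\<lambda>x. 1 \<le> x) T)"
      using phi_steps_below[OF assms(2) tab, of m "n - 1"] assms(1)
      by (simp add: phi_def lookup)
    moreover have "filter (\<lambda>x. 1 \<le> x) T = T"
      using set by (auto intro: filter_True)
    ultimately show ?thesis by force
  qed
  have "bij_betw (\<lambda>m. the (phi n h m)) (N_monomials n h) (P_tableaux n h)"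
    unfolding bij_betw_def
  proof (intro conjI inj equalityI subsetI)
    fix T assume "T \<in> (\<lambda>m. the (phi n h m)) ` N_monomials n h"
    then show "T \<in> P_tableaux n h" using phi by (fastforce simp: P_tableaux_iff)
  qed (rule surj)
  moreover have "(\<Sum>k=1..n. Poly_Mapping.lookup m k) = P_inv n h (the (phi n h m))"
    if "m \<in> N_monomials n h" for m
  proof -
    obtain T where T: "phi n h m = Some T" "partial_tableau n h 1 T"
        "\<forall>k\<in>{1..n}. below h k T = Poly_Mapping.lookup m k"
      using phi[OF \<open>m \<in> N_monomials n h\<close>] by blast
    then show ?thesis using P_inv_eq_sum_below[OF assms(2) T(2)] by simp
  qed
  ultimately show ?thesis using phi by fastforce
qed

end
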